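(* Let $c$ be a colouring of the points of a projective plane $P$. Then every line of $P$ contains points of at most two colours if and only if either (1) $|c|\le2$, or (2) there are colours $\alpha,\beta_1,\beta_2$ such that the set of colours used by $c$ is $\{\alpha,\beta_1,\beta_2\}$, and either (i) there is a point $x$ of $P$ with $c(x)=\alpha$ such that each line $L$ through $x$ satisfies $c(L-\{x\})=\{\beta_1\}$ or $c(L-\{x\})=\{\beta_2\}$; or (ii) there is a line $L$ of $P$ such that $c(P-L)=\{\alpha\}$, $c(L)=\{\beta_1,\beta_2\}$, and $L$ contains at least two points of each of the colours $\beta_1,\beta_2$.
   Context: A projective plane here is any finite projective plane (not necessarily Desarguesian), i.e. a set of points with lines such that any two points lie on a unique line, any two lines meet in a unique point, and there are four points no three collinear. $|c|$ is the number of colours used and $c(X)$ is the set of colours appearing on $X$. *)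

theory Defs
  imports Main
begin

text \<open>Lines are represented by their point sets. Nothing is lost: in any incidence structure
  satisfying the axioms below, distinct lines are incident with distinct sets of points.\<close>

locale projective_plane =
  fixes P :: "'a set" and Lines :: "'a set set"
  assumes finite_points: "finite P"
    and line_subset: "L \<in> Lines \<Longrightarrow> L \<subseteq> P"
    and join: "\<lbrakk>x \<in> P; y \<in> P; x \<noteq> y\<rbrakk> \<Longrightarrow> \<exists>!L. L \<in> Lines \<and> x \<in> L \<and> y \<in> L"
    and meet: "\<lbrakk>L \<in> Lines; M \<in> Lines; L \<noteq> M\<rbrakk> \<Longrightarrow> \<exists>!x. x \<in> P \<and> x \<in> L \<and> x \<in> M"
    and quadrangle: "\<exists>Q. Q \<subseteq> P \<and> card Q = 4 \<and>
      (\<forall>T. T \<subseteq> Q \<and> card T = 3 \<longrightarrow> \<not> (\<exists>L\<in>Lines. T \<subseteq> L))"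

end

theory Submission
  imports Defs
begin

text \<open>Assume that every line has at most two colours and that at least three colours occur. A line
  joining two colours meets a line joining two others, so there are exactly three colour classes
  $A$, $B$, $C$; and a monochromatic line would meet a line joining the other two colours, so every
  line misses exactly one class. Projecting a line that misses $A$ from a point of $A$ shows that
  all lines missing $A$ contain the same number $x$ of points of $B$, and counting $B$ through this
  point gives $|B| = x (N - z)$, where $N$ is the number of points on a line and $z$ is the number
  of points of $A$ on a line missing $C$. Cyclically $|C| = y (N - x)$ and $|A| = z (N - y)$, so
  $x (N - z) + y (N - x) + z (N - y) = N^2 - N + 1$. After a factorisation this forces either
  a class of size $1$, or two classes with $N$ points altogether, which then form a line.\<close>

section \<open>Incidence and counting in a finite projective plane\<close>

context projective_plane
begin

text \<open>The description is proper for distinct points of \<open>P\<close>, where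
  \<open>join\<close> gives unique existence.\<close>

definition line_through :: "'a \<Rightarrow> 'a \<Rightarrow> 'a set" where
  "line_through x y = (THE L. L \<in> Lines \<and> x \<in> L \<and> y \<in> L)"

lemma line_through:
  assumes "x \<in> P" "y \<in> P" "x \<noteq> y"
  shows "line_through x y \<in> Lines" "x \<in> line_through x y" "y \<in> line_through x y"
  using theI'[OF join[OF assms]] unfolding line_through_def by blast+

lemma line_eqI:
  assumes "L \<in> Lines" "M \<in> Lines" "x \<in> L" "y \<in> L" "x \<in> M" "y \<in> M" "x \<noteq> y"
  shows "L = M"
proof -
  have "x \<in> P" "y \<in> P" using assms(1,3,4) line_subset by auto
  from join[OF this assms(7)] show ?thesis using assms(1-6) by (elim ex1E) metis
qed

lemma line_through_eq:
  assumes "L \<in> Lines" "x \<in> L" "y \<in> L" "x \<noteq> y"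
  shows "line_through x y = L"
proof -
  have "x \<in> P" "y \<in> P" using assms line_subset by blast+
  then show ?thesis
    using assms line_eqI line_through[of x y] by metis
qed

lemma finite_line: "L \<in> Lines \<Longrightarrow> finite L"
  using finite_points line_subset finite_subset by blast

lemma finite_lines: "finite Lines"
  using finite_points line_subset by (meson PowI finite_Pow_iff finite_subset subsetI)

lemma lines_meet:
  assumes "L \<in> Lines" "M \<in> Lines" "L \<noteq> M"
  obtains x where "x \<in> P" "x \<in> L" "x \<in> M"
  using meet[OF assms] by blast

text \<open>Joining to \<open>p\<close> is a bijection from \<open>S\<close> to these lines: two
  points of \<open>S\<close> on one line through \<open>p\<close> would make that line equal to
  \<open>L\<close>, which avoids \<open>p\<close>.\<close>

lemma card_pencil:
  assumes p: "p \<in> P" "p \<notin> L" and L: "L \<in> Lines" and S: "S \<subseteq> L"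
  shows "card {M \<in> Lines. p \<in> M \<and> M \<inter> S \<noteq> {}} = card S"
proof -
  have SP: "q \<in> P \<and> q \<noteq> p" if "q \<in> S" for q
    using that S p line_subset[OF L] by blast
  have inj: "inj_on (line_through p) S"
  proof (rule inj_onI, rule ccontr)
    fix q r assume qr: "q \<in> S" "r \<in> S" "line_through p q = line_through p r" "q \<noteq> r"
    have "line_through p q = L"
      using line_eqI[of "line_through p q" L q r] line_through[of p q] line_through[of p r]
        qr SP[of q] SP[of r] p L S by auto
    then show False
      using line_through[of p q] SP[of q] qr p by auto
  qed
  have "line_through p ` S = {M \<in> Lines. p \<in> M \<and> M \<inter> S \<noteq> {}}"
  proof (intro equalityI subsetI)
    fix M assume "M \<in> line_through p ` S"
    then show "M \<in> {M \<in> Lines. p \<in> M \<and> M \<inter> S \<noteq> {}}"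
      using line_through[of p] SP p by fastforce
  next
    fix M assume "M \<in> {M \<in> Lines. p \<in> M \<and> M \<inter> S \<noteq> {}}"
    then obtain q where "M \<in> Lines" "p \<in> M" "q \<in> M" "q \<in> S" by blast
    then have "M = line_through p q"
      using line_through_eq SP by metis
    then show "M \<in> line_through p ` S" using \<open>q \<in> S\<close> by blast
  qed
  then show ?thesis using card_image[OF inj] by simp
qed

text \<open>The lines through \<open>p\<close> partition the other points, so they cut
  \<open>X\<close> into disjoint traces, each nonempty one of size \<open>k\<close>.\<close>

lemma card_by_pencil:
  assumes p: "p \<in> P" and X: "X \<subseteq> P - {p}"
    and k: "\<And>M. \<lbrakk>M \<in> Lines; p \<in> M; M \<inter> X \<noteq> {}\<rbrakk> \<Longrightarrow> card (M \<inter> X) = k"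
  shows "card X = card {M \<in> Lines. p \<in> M \<and> M \<inter> X \<noteq> {}} * k"
proof -
  let ?I = "{M \<in> Lines. p \<in> M \<and> M \<inter> X \<noteq> {}}"
  have "X = (\<Union>M\<in>?I. M \<inter> X)"
  proof (intro equalityI subsetI)
    fix q assume q: "q \<in> X"
    then have "q \<in> P" "p \<noteq> q" using X by auto
    from line_through[OF p this] q show "q \<in> (\<Union>M\<in>?I. M \<inter> X)" by blast
  qed auto
  moreover have "card (\<Union>M\<in>?I. M \<inter> X) = (\<Sum>M\<in>?I. card (M \<inter> X))"
  proof (rule card_UN_disjoint)
    show "\<forall>M\<in>?I. \<forall>M'\<in>?I. M \<noteq> M' \<longrightarrow> M \<inter> X \<inter> (M' \<inter> X) = {}"
      using line_eqI X by blast
  qed (auto simp: finite_lines finite_line)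
  ultimately show ?thesis using k by simp
qed

text \<open>If \<open>L\<close> and \<open>M\<close> covered \<open>P\<close>, each would contain
  two points of the quadrangle off the other, and a diagonal point of the quadrangle would lie on
  neither line.\<close>

lemma point_off_two_lines:
  assumes L: "L \<in> Lines" and M: "M \<in> Lines"
  obtains p where "p \<in> P" "p \<notin> L" "p \<notin> M"
proof (rule ccontr)
  assume "\<not> thesis"
  with that have cover: "P \<subseteq> L \<union> M" by blast
  from quadrangle obtain Q where Q: "Q \<subseteq> P" "card Q = 4"
    and quad: "\<forall>T. T \<subseteq> Q \<and> card T = 3 \<longrightarrow> \<not> (\<exists>L\<in>Lines. T \<subseteq> L)"
    by (elim exE conjE)
  have no3: "\<not> T \<subseteq> K" if "T \<subseteq> Q" "card T = 3" "K \<in> Lines" for T K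
    using quad[rule_format, of T] that by simp
  have finQ: "finite Q" using Q by (metis card.infinite zero_neq_numeral)
  have le2: "card (Q \<inter> K) \<le> 2" if K: "K \<in> Lines" for K
  proof (rule ccontr)
    assume "\<not> card (Q \<inter> K) \<le> 2"
    then have "3 \<le> card (Q \<inter> K)" by simp
    then obtain T where "T \<subseteq> Q \<inter> K" "card T = 3" by (meson obtain_subset_with_card_n)
    then show False using no3 K by blast
  qed
  have "Q = (Q \<inter> L) \<union> (Q \<inter> M)" using Q cover by blast
  then have "card Q \<le> card (Q \<inter> L) + card (Q \<inter> M)"
    by (metis card_Un_le)
  moreover have "card Q = card (Q \<inter> L) + card (Q - L)"
    using finQ by (metis card_Int_Diff)
  moreover have "card Q = card (Q \<inter> M) + card (Q - M)"
    using finQ by (metis card_Int_Diff)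
  \<comment> \<open>Neither line holds more than two of the four points, so covering them forces
    exactly two on each and none on both.\<close>
  ultimately have "card (Q - M) = 2" "card (Q - L) = 2"
    using le2[OF L] le2[OF M] Q by linarith+
  then obtain a b d e where ab: "Q - M = {a, b}" "a \<noteq> b" and de: "Q - L = {d, e}" "d \<noteq> e"
    unfolding card_2_iff by blast
  have "a \<in> Q - M" "b \<in> Q - M" "d \<in> Q - L" "e \<in> Q - L" using ab de by simp_all
  then have PQ: "a \<in> P" "b \<in> P" "d \<in> P" "e \<in> P"
    and mem: "a \<in> L" "b \<in> L" "a \<notin> M" "b \<notin> M" "d \<in> M" "e \<in> M" "d \<notin> L" "e \<notin> L"
    using Q(1) cover by blast+
  have ad: "a \<noteq> d" and be: "b \<noteq> e" using mem by auto
  \<comment> \<open>The joins of \<open>a, d\<close> and of \<open>b, e\<close> meet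
    \<open>L\<close> in different points \<open>a\<close>, \<open>b\<close> and meet
    \<open>M\<close> in different points \<open>d\<close>, \<open>e\<close>, so their common point
    is off both lines.\<close>
  note 1 = line_through[OF PQ(1,3) ad] and 2 = line_through[OF PQ(2,4) be]
  have bn: "b \<notin> line_through a d"
    using line_eqI[OF 1(1) L 1(2) _ mem(1,2) ab(2)] 1(3) mem(7) by blast
  then have "line_through a d \<noteq> line_through b e" using 2(2) by metis
  then obtain q where q: "q \<in> P" "q \<in> line_through a d" "q \<in> line_through b e"
    by (rule lines_meet[OF 1(1) 2(1)])
  have "q \<notin> L"
    using line_eqI[OF 2(1) L q(3) 2(2) _ mem(2)] 2(3) mem(8) q(2) bn by metis
  moreover have "q \<notin> M"
  proof
    assume "q \<in> M"
    then have "q = d" using line_eqI[OF 1(1) M q(2) 1(3) _ mem(5)] 1(2) mem(3) by metis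
    moreover have "q = e"
      using \<open>q \<in> M\<close> line_eqI[OF 2(1) M q(3) 2(3) _ mem(6)] 2(2) mem(4) by metis
    ultimately show False using de by simp
  qed
  ultimately show False using q cover by blast
qed

lemma card_pencil_all:
  assumes "p \<in> P" "p \<notin> L" "L \<in> Lines"
  shows "card {M \<in> Lines. p \<in> M} = card L"
proof -
  have "M \<inter> L \<noteq> {}" if "M \<in> Lines" "p \<in> M" for M
    using that assms lines_meet[of M L] by blast
  then have "{M \<in> Lines. p \<in> M} = {M \<in> Lines. p \<in> M \<and> M \<inter> L \<noteq> {}}" by blast
  then show ?thesis using card_pencil[OF assms, of L] by simp
qed

text \<open>Both sizes equal the number of lines through a point off both lines.\<close>

lemma card_line_eq:
  assumes "L \<in> Lines" "M \<in> Lines"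
  shows "card L = card M"
proof -
  obtain p where "p \<in> P" "p \<notin> L" "p \<notin> M" using point_off_two_lines[OF assms] .
  then show ?thesis using card_pencil_all[of p L] card_pencil_all[of p M] assms by simp
qed

text \<open>Through a point off \<open>L\<close> there pass \<open>card L\<close> lines, each with
  \<open>card L - 1\<close> further points.\<close>

lemma card_points:
  assumes L: "L \<in> Lines"
  shows "card P = Suc (card L * (card L - 1))"
proof -
  obtain p where p: "p \<in> P" "p \<notin> L" using point_off_two_lines[OF L L] .
  have "card (P - {p}) = card {M \<in> Lines. p \<in> M \<and> M \<inter> (P - {p}) \<noteq> {}} * (card L - 1)"
  proof (rule card_by_pencil[OF p(1) subset_refl])
    fix M assume M: "M \<in> Lines" "p \<in> M"
    then have "M \<inter> (P - {p}) = M - {p}" using line_subset by blast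
    then show "card (M \<inter> (P - {p})) = card L - 1"
      using M card_line_eq[OF M(1) L] finite_line by simp
  qed
  also have "{M \<in> Lines. p \<in> M \<and> M \<inter> (P - {p}) \<noteq> {}} = {M \<in> Lines. p \<in> M}"
  proof -
    have "M \<inter> (P - {p}) \<noteq> {}" if "M \<in> Lines" "p \<in> M" for M
      using lines_meet[OF that(1) L] that p by blast
    then show ?thesis by blast
  qed
  finally have "card (P - {p}) = card L * (card L - 1)"
    using card_pencil_all[OF p L] by simp
  then show ?thesis using card_Suc_Diff1[OF finite_points p(1)] by simp
qed

end

section \<open>Partitions into three classes such that every line misses one\<close>

locale three_classes = projective_plane P Lines
  for P :: "'a set" and Lines :: "'a set set" +
  fixes A B C :: "'a set"
  assumes cover: "P = A \<union> B \<union> C"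
    and disjoint: "A \<inter> B = {}" "B \<inter> C = {}" "C \<inter> A = {}"
    and nonempty: "A \<noteq> {}" "B \<noteq> {}" "C \<noteq> {}"
    and line_misses: "L \<in> Lines \<Longrightarrow> L \<inter> A = {} \<or> L \<inter> B = {} \<or> L \<inter> C = {}"
begin

text \<open>The locale assumptions are symmetric in the classes. Together with
  \<open>reflect\<close> this gives all permutations, so a fact proved for one order of the classes
  is available for every other.\<close>

lemma rotate: "three_classes P Lines B C A"
  by unfold_locales (use cover disjoint nonempty line_misses in blast)+

lemma reflect: "three_classes P Lines A C B"
  by unfold_locales (use cover disjoint nonempty line_misses in blast)+

lemma line_missing_first:
  obtains L where "L \<in> Lines" "L \<inter> A = {}" "L \<inter> B \<noteq> {}" "L \<inter> C \<noteq> {}"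
proof -
  obtain b d where bd: "b \<in> B" "d \<in> C" using nonempty by blast
  then have "b \<in> P" "d \<in> P" "b \<noteq> d" using cover disjoint by auto
  from line_through[OF this] bd show thesis
    using line_misses that[of "line_through b d"] by blast
qed

text \<open>Otherwise \<open>L\<close> would lie in \<open>C\<close> and could not meet a line
  joining \<open>A\<close> to \<open>B\<close>, which misses \<open>C\<close>.\<close>

lemma missing_first_meets:
  assumes L: "L \<in> Lines" "L \<inter> A = {}"
  shows "L \<inter> B \<noteq> {}"
proof
  assume LB: "L \<inter> B = {}"
  obtain M where M: "M \<in> Lines" "M \<inter> C = {}" "M \<inter> A \<noteq> {}" "M \<inter> B \<noteq> {}"
    by (rule three_classes.line_missing_first[OF three_classes.rotate[OF rotate]])
  then have "L \<noteq> M" using L by blast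
  then obtain q where "q \<in> P" "q \<in> L" "q \<in> M" using lines_meet L M by blast
  then show False using L LB M cover by blast
qed

text \<open>A line through \<open>a\<close> that meets \<open>B\<close> misses \<open>C\<close>, so
  its intersection with \<open>L\<close>, being outside \<open>A\<close>, lies in \<open>B\<close>.
  Thus the lines counted are those from \<open>a\<close> to the points of
  \<open>L \<inter> B\<close>.\<close>

lemma class_pencil:
  assumes "a \<in> A" "L \<in> Lines" "L \<inter> A = {}"
  shows "card {M \<in> Lines. a \<in> M \<and> M \<inter> B \<noteq> {}} = card (L \<inter> B)"
proof -
  have a: "a \<in> P" "a \<notin> L" using assms cover by auto
  have "{M \<in> Lines. a \<in> M \<and> M \<inter> B \<noteq> {}} = {M \<in> Lines. a \<in> M \<and> M \<inter> (L \<inter> B) \<noteq> {}}"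
  proof (intro Collect_cong conj_cong refl iffI)
    fix M assume M: "M \<in> Lines" "a \<in> M" "M \<inter> B \<noteq> {}"
    then have "M \<inter> C = {}" using line_misses assms by blast
    moreover obtain q where "q \<in> P" "q \<in> M" "q \<in> L" using lines_meet[of M L] M assms by blast
    ultimately show "M \<inter> (L \<inter> B) \<noteq> {}" using assms cover by blast
  qed blast
  then show ?thesis using card_pencil[OF a assms(2), of "L \<inter> B"] by simp
qed

text \<open>Both traces have as many points as there are lines through a fixed point of
  \<open>A\<close> that meet \<open>B\<close>.\<close>

lemma class_trace_eq:
  assumes "L \<in> Lines" "L \<inter> A = {}" "M \<in> Lines" "M \<inter> A = {}"
  shows "card (L \<inter> B) = card (M \<inter> B)"
proof -
  obtain a where "a \<in> A" using nonempty by blast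
  then show ?thesis using class_pencil[of a L] class_pencil[of a M] assms by simp
qed

text \<open>Project \<open>B\<close> from a point of \<open>A\<close>: the first factor counts the
  lines through it that meet \<open>B\<close>. These miss \<open>C\<close>, so by
  \<open>class_trace_eq\<close> with \<open>C\<close> in the first place they all have the same
  trace size on \<open>B\<close>, the second factor.\<close>

lemma card_class:
  assumes L: "L \<in> Lines" "L \<inter> A = {}" and M: "M \<in> Lines" "M \<inter> C = {}"
  shows "card B = card (L \<inter> B) * card (M \<inter> B)"
proof -
  obtain a where a: "a \<in> A" using nonempty by blast
  interpret CBA: three_classes P Lines C B A
    by (rule three_classes.reflect[OF three_classes.rotate[OF rotate]])
  have "card B = card {K \<in> Lines. a \<in> K \<and> K \<inter> B \<noteq> {}} * card (M \<inter> B)"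
  proof (rule card_by_pencil)
    show "a \<in> P" "B \<subseteq> P - {a}" using a cover disjoint by auto
    fix K assume K: "K \<in> Lines" "a \<in> K" "K \<inter> B \<noteq> {}"
    then have "K \<inter> C = {}" using line_misses a by blast
    then show "card (K \<inter> B) = card (M \<inter> B)" using CBA.class_trace_eq K M by blast
  qed
  then show ?thesis using class_pencil[OF a L] by simp
qed

lemma card_line_missing_first:
  assumes "L \<in> Lines" "L \<inter> A = {}"
  shows "card L = card (L \<inter> B) + card (L \<inter> C)"
proof -
  have "L = (L \<inter> B) \<union> (L \<inter> C)" using assms line_subset[of L] cover by blast
  moreover have "card ((L \<inter> B) \<union> (L \<inter> C)) = card (L \<inter> B) + card (L \<inter> C)"
    using disjoint finite_line[OF assms(1)] by (intro card_Un_disjoint) auto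
  ultimately show ?thesis by simp
qed

text \<open>A line missing \<open>A\<close> is contained in \<open>B \<union> C\<close>, so equal
  sizes force equality.\<close>

lemma union_is_line:
  assumes L: "L \<in> Lines" "L \<inter> A = {}" and "card B + card C = card L"
  shows "B \<union> C \<in> Lines"
proof -
  have fin: "finite B" "finite C" using finite_points cover by auto
  have "L \<subseteq> B \<union> C" using L line_subset[of L] cover by blast
  moreover have "card (B \<union> C) = card L"
    using assms fin disjoint by (simp add: card_Un_disjoint)
  ultimately have "L = B \<union> C" using fin by (intro card_subset_eq) auto
  then show ?thesis using L by simp
qed

end

section \<open>The integer equation for the trace sizes\<close>

lemma product_sum_aux:
  fixes x y z p q w N :: int
  assumes pos: "1 \<le> x" "1 \<le> y" "1 \<le> z" "1 \<le> p" "1 \<le> q" "1 \<le> w"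
    and N: "x + p = N" "y + q = N" "z + w = N"
    and sum: "x * w + y * p + z * q = N * (N - 1) + 1"
    and le: "p + q \<le> N"
  shows "z * q = 1 \<or> x * w = 1 \<or> y * p = 1 \<or>
    z * q + x * w = N \<or> x * w + y * p = N \<or> y * p + z * q = N"
proof -
  have e: "x = N - p" "y = N - q" "w = N - z" using N by auto
  \<comment> \<open>This is \<open>sum\<close> rewritten in \<open>p\<close>, \<open>q\<close>,
    \<open>z\<close>, \<open>N\<close>. By \<open>le\<close> both summands are nonnegative, so both
    vanish.\<close>
  have "(p - 1) * (q - 1) + (z - 1) * (N - p - q) = 0"
    using sum unfolding e by (simp add: algebra_simps)
  moreover have "0 \<le> (p - 1) * (q - 1)" "0 \<le> (z - 1) * (N - p - q)"
    using pos le by simp_all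
  ultimately have "(p - 1) * (q - 1) = 0" "(z - 1) * (N - p - q) = 0" by linarith+
  \<comment> \<open>For \<open>z = 1\<close>, the choices of \<open>p\<close> and \<open>q\<close>
    give \<open>y * p + z * q = N\<close> and \<open>z * q = 1\<close>; for \<open>p + q = N\<close>
    they give \<open>y * p = 1\<close> and \<open>z * q + x * w = N\<close>.\<close>
  then have "p = 1 \<or> q = 1" "z = 1 \<or> p + q = N" by auto
  then show ?thesis using N by auto
qed

text \<open>If \<open>p + q > N\<close>, then \<open>x + y < N\<close>, because
  \<open>x + y + p + q = 2 * N\<close>. Exchanging \<open>x\<close> with \<open>q\<close>,
  \<open>y\<close> with \<open>p\<close> and \<open>z\<close> with \<open>w\<close> preserves the
  equations and reduces to \<open>product_sum_aux\<close>; for the classes this interchanges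
  \<open>A\<close> and \<open>B\<close>.\<close>

lemma product_sum:
  fixes x y z p q w N :: int
  assumes pos: "1 \<le> x" "1 \<le> y" "1 \<le> z" "1 \<le> p" "1 \<le> q" "1 \<le> w"
    and N: "x + p = N" "y + q = N" "z + w = N"
    and sum: "x * w + y * p + z * q = N * (N - 1) + 1"
  shows "z * q = 1 \<or> x * w = 1 \<or> y * p = 1 \<or>
    z * q + x * w = N \<or> x * w + y * p = N \<or> y * p + z * q = N"
proof (cases "p + q \<le> N")
  case True
  then show ?thesis using product_sum_aux[OF pos N sum] by blast
next
  case False
  have "q * z + p * y + w * x = N * (N - 1) + 1" using sum by (simp add: algebra_simps)
  then have "w * x = 1 \<or> q * z = 1 \<or> p * y = 1 \<or>
    w * x + q * z = N \<or> q * z + p * y = N \<or> p * y + w * x = N"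
    using False pos N by (intro product_sum_aux[of q p w y x z N]) linarith+
  then show ?thesis
    unfolding mult.commute[of w x] mult.commute[of q z] mult.commute[of p y] by linarith
qed

section \<open>A class of size one or two classes forming a line\<close>

context three_classes
begin

lemma singleton_or_line:
  "card A = 1 \<or> card B = 1 \<or> card C = 1 \<or>
   A \<union> B \<in> Lines \<or> B \<union> C \<in> Lines \<or> C \<union> A \<in> Lines"
proof -
  interpret BCA: three_classes P Lines B C A by (rule rotate)
  interpret CAB: three_classes P Lines C A B by (rule BCA.rotate)
  obtain L where L: "L \<in> Lines" "L \<inter> A = {}" "L \<inter> B \<noteq> {}" "L \<inter> C \<noteq> {}"
    by (rule line_missing_first)
  obtain M where M: "M \<in> Lines" "M \<inter> B = {}" "M \<inter> C \<noteq> {}" "M \<inter> A \<noteq> {}"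
    by (rule BCA.line_missing_first)
  obtain K where K: "K \<in> Lines" "K \<inter> C = {}" "K \<inter> A \<noteq> {}" "K \<inter> B \<noteq> {}"
    by (rule CAB.line_missing_first)
  define N where "N = card L"
  have cM: "card M = N" and cK: "card K = N" 
    unfolding N_def using card_line_eq[OF M(1) L(1)] card_line_eq[OF K(1) L(1)] by blast+
  \<comment> \<open>Needed to turn the truncated \<open>N - 1\<close> in \<open>card_points\<close>
    into integer subtraction.\<close>
  have N1: "N \<ge> 1" using L finite_line by (auto simp: N_def Suc_le_eq card_gt_0_iff)
  have cB: "card B = card (L \<inter> B) * card (K \<inter> B)" using card_class[OF L(1,2) K(1,2)] .
  have cC: "card C = card (M \<inter> C) * card (L \<inter> C)" using BCA.card_class[OF M(1,2) L(1,2)] .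
  have cA: "card A = card (K \<inter> A) * card (M \<inter> A)" using CAB.card_class[OF K(1,2) M(1,2)] .
  have fin: "finite A" "finite B" "finite C" using finite_points cover by auto
  have "card P = card A + card B + card C"
    unfolding cover using fin disjoint
    by (simp add: card_Un_disjoint Int_Un_distrib2 Int_commute[of A C])
  then have tot: "card A + card B + card C = Suc (N * (N - 1))"
    using card_points[OF L(1)] N_def by simp
  have pos: "card (X \<inter> Y) \<ge> 1" if "X \<in> Lines" "X \<inter> Y \<noteq> {}" for X Y
    using that finite_line by (auto simp: Suc_le_eq card_gt_0_iff)
  have "int (card A) = 1 \<or> int (card B) = 1 \<or> int (card C) = 1 \<or>
    int (card A) + int (card B) = int N \<or> int (card B) + int (card C) = int N \<or>
    int (card C) + int (card A) = int N"
    unfolding cA cB cC of_nat_mult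
  proof (rule product_sum)
    show "int (card (L \<inter> B)) + int (card (L \<inter> C)) = int N"
      using card_line_missing_first[OF L(1,2)] N_def by simp
    show "int (card (M \<inter> C)) + int (card (M \<inter> A)) = int N"
      using BCA.card_line_missing_first[OF M(1,2)] cM by simp
    show "int (card (K \<inter> A)) + int (card (K \<inter> B)) = int N"
      using CAB.card_line_missing_first[OF K(1,2)] cK by simp
    have "int (card A + card B + card C) = int N * (int N - 1) + 1"
      unfolding tot using N1 by (simp add: of_nat_diff)
    then show "int (card (L \<inter> B)) * int (card (K \<inter> B)) + int (card (M \<inter> C)) * int (card (L \<inter> C))
      + int (card (K \<inter> A)) * int (card (M \<inter> A)) = int N * (int N - 1) + 1"
      unfolding cA cB cC by simp
  qed (use pos[OF L(1,3)] pos[OF L(1,4)] pos[OF M(1,3)] pos[OF M(1,4)]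
      pos[OF K(1,3)] pos[OF K(1,4)] in linarith)+
  then have "card A = 1 \<or> card B = 1 \<or> card C = 1 \<or>
    card A + card B = N \<or> card B + card C = N \<or> card C + card A = N"
    by linarith
  \<comment> \<open>Two classes with \<open>N\<close> points in all are compared with the line,
    among \<open>L\<close>, \<open>M\<close> and \<open>K\<close>, that misses the third
    class.\<close>
  then show ?thesis
    using union_is_line[OF L(1,2)] BCA.union_is_line[OF M(1,2)] CAB.union_is_line[OF K(1,2)]
    unfolding cM cK N_def[symmetric] by blast
qed

end

section \<open>Colourings described by their colour classes\<close>

text \<open>The colours are arguments, with the distinguished one first, so that the three cyclic
  orders can be treated as separate cases.\<close>

definition exceptional_colouring :: "'a set \<Rightarrow> 'a set set \<Rightarrow> ('a \<Rightarrow> 'b) \<Rightarrow> 'b \<Rightarrow> 'b \<Rightarrow> 'b \<Rightarrow> bool" where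
  "exceptional_colouring P Lines c \<alpha> \<beta> \<gamma> \<longleftrightarrow> c ` P = {\<alpha>, \<beta>, \<gamma>} \<and>
     ((\<exists>x\<in>P. c x = \<alpha> \<and> (\<forall>L\<in>Lines. x \<in> L \<longrightarrow> c ` (L - {x}) = {\<beta>} \<or> c ` (L - {x}) = {\<gamma>})) \<or>
      (\<exists>L\<in>Lines. c ` (P - L) = {\<alpha>} \<and> c ` L = {\<beta>, \<gamma>} \<and>
         card {y \<in> L. c y = \<beta>} \<ge> 2 \<and> card {y \<in> L. c y = \<gamma>} \<ge> 2))"

text \<open>With colour classes as the three sets, permuting the colours permutes the classes, and
  \<open>rotate\<close> and \<open>reflect\<close> apply directly.\<close>

locale three_coloured_plane =
  three_classes P Lines "{y \<in> P. c y = \<alpha>}" "{y \<in> P. c y = \<beta>}" "{y \<in> P. c y = \<gamma>}"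
  for P :: "'a set" and Lines :: "'a set set" and c :: "'a \<Rightarrow> 'b" and \<alpha> \<beta> \<gamma> :: 'b
begin

lemma range_colours: "c ` P = {\<alpha>, \<beta>, \<gamma>}"
  using cover nonempty by blast

lemma distinct_colours: "\<alpha> \<noteq> \<beta>" "\<beta> \<noteq> \<gamma>" "\<gamma> \<noteq> \<alpha>"
  using nonempty disjoint by auto

text \<open>A line through the only point \<open>x\<close> of colour \<alpha> meets that class,
  hence misses one of the other two; by \<open>missing_first_meets\<close> it meets the remaining
  one.\<close>

lemma singleton_class_form:
  assumes "card {y \<in> P. c y = \<alpha>} = 1"
  shows "exceptional_colouring P Lines c \<alpha> \<beta> \<gamma>"
proof -
  interpret BCA: three_coloured_plane P Lines c \<beta> \<gamma> \<alpha>
    unfolding three_coloured_plane_def by (rule rotate)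
  interpret CAB: three_coloured_plane P Lines c \<gamma> \<alpha> \<beta>
    unfolding three_coloured_plane_def by (rule BCA.rotate)
  interpret CBA: three_coloured_plane P Lines c \<gamma> \<beta> \<alpha>
    unfolding three_coloured_plane_def by (rule CAB.reflect)
  obtain x where x: "{y \<in> P. c y = \<alpha>} = {x}" using assms card_1_singletonE by blast
  then have xP: "x \<in> P" "c x = \<alpha>" by auto
  have "c ` (L - {x}) = {\<beta>} \<or> c ` (L - {x}) = {\<gamma>}" if L: "L \<in> Lines" "x \<in> L" for L
  proof -
    have LP: "L \<subseteq> P" using line_subset L by blast
    have rest: "c y = \<beta> \<or> c y = \<gamma>" if "y \<in> L - {x}" for y
      using that LP range_colours x by blast
    have "L \<inter> {y \<in> P. c y = \<beta>} = {} \<or> L \<inter> {y \<in> P. c y = \<gamma>} = {}"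
      using line_misses[OF L(1)] L xP by blast
    then show ?thesis
    proof
      assume h: "L \<inter> {y \<in> P. c y = \<beta>} = {}"
      then obtain y where "y \<in> L" "c y = \<gamma>" using BCA.missing_first_meets L by blast
      then show ?thesis using h rest LP xP distinct_colours by blast
    next
      assume h: "L \<inter> {y \<in> P. c y = \<gamma>} = {}"
      then obtain y where "y \<in> L" "c y = \<beta>" using CBA.missing_first_meets L by blast
      then show ?thesis using h rest LP xP distinct_colours by blast
    qed
  qed
  then show ?thesis unfolding exceptional_colouring_def
    by (intro conjI range_colours disjI1[of "Bex _ _"] bexI[of _ x] ballI impI xP)
qed

text \<open>The complement of this line is the class of \<alpha>. The classes on the line are
  nonempty and not singletons, which gives two points of each colour.\<close>

lemma line_class_form:
  assumes L: "{y \<in> P. c y = \<beta>} \<union> {y \<in> P. c y = \<gamma>} \<in> Lines"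
    and "card {y \<in> P. c y = \<beta>} \<noteq> 1" "card {y \<in> P. c y = \<gamma>} \<noteq> 1"
  shows "exceptional_colouring P Lines c \<alpha> \<beta> \<gamma>"
proof -
  let ?L = "{y \<in> P. c y = \<beta>} \<union> {y \<in> P. c y = \<gamma>}"
  have "P - ?L = {y \<in> P. c y = \<alpha>}" using cover disjoint by blast
  then have "c ` (P - ?L) = {\<alpha>}" using nonempty by blast
  moreover have "c ` ?L = {\<beta>, \<gamma>}" using nonempty by blast
  moreover have "{y \<in> ?L. c y = \<beta>} = {y \<in> P. c y = \<beta>}" "{y \<in> ?L. c y = \<gamma>} = {y \<in> P. c y = \<gamma>}"
    by auto
  moreover have "card {y \<in> P. c y = \<beta>} \<noteq> 0" "card {y \<in> P. c y = \<gamma>} \<noteq> 0"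
    using nonempty finite_points by auto
  ultimately show ?thesis unfolding exceptional_colouring_def using range_colours L assms
    by (intro conjI disjI2 bexI[of _ ?L]) simp_all
qed

text \<open>A singleton class, if there is one, yields the form with a point. Otherwise two classes
  form a line, and no class being a singleton secures the two points per colour.\<close>

lemma exceptional_colouring_cases:
  "exceptional_colouring P Lines c \<alpha> \<beta> \<gamma> \<or> exceptional_colouring P Lines c \<beta> \<gamma> \<alpha> \<or>
   exceptional_colouring P Lines c \<gamma> \<alpha> \<beta>"
proof -
  interpret BCA: three_coloured_plane P Lines c \<beta> \<gamma> \<alpha>
    unfolding three_coloured_plane_def by (rule rotate)
  interpret CAB: three_coloured_plane P Lines c \<gamma> \<alpha> \<beta>
    unfolding three_coloured_plane_def by (rule BCA.rotate)
  show ?thesis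
    using singleton_or_line singleton_class_form BCA.singleton_class_form CAB.singleton_class_form
      line_class_form BCA.line_class_form CAB.line_class_form by argo
qed

end

section \<open>The two directions of the equivalence\<close>

lemma (in projective_plane) card_colours_le_2I:
  assumes "exceptional_colouring P Lines c \<alpha> \<beta> \<gamma>" and L: "L \<in> Lines"
  shows "card (c ` L) \<le> 2"
proof -
  have two: "card (c ` L) \<le> 2" if "c ` L \<subseteq> {d, e}" for d e
    using card_mono[OF _ that] card_2_iff[of "{d, e}"] by (cases "d = e") auto
  have LP: "L \<subseteq> P" using L line_subset by blast
  from assms(1) show ?thesis
    unfolding exceptional_colouring_def
  proof (elim conjE disjE bexE)
    fix x assume x: "x \<in> P"
      and pencil: "\<forall>L\<in>Lines. x \<in> L \<longrightarrow> c ` (L - {x}) = {\<beta>} \<or> c ` (L - {x}) = {\<gamma>}"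
    show ?thesis
    proof (cases "x \<in> L")
      case True
      then have "c ` L = insert (c x) (c ` (L - {x}))" by blast
      moreover have "c ` (L - {x}) = {\<beta>} \<or> c ` (L - {x}) = {\<gamma>}"
        using pencil L True by simp
      ultimately show ?thesis using two by fastforce
    next
      case False
      \<comment> \<open>Every point other than \<open>x\<close> gets its colour from the line
        joining it to \<open>x\<close>.\<close>
      have "c y \<in> {\<beta>, \<gamma>}" if "y \<in> L" for y
      proof -
        have y: "y \<in> P" "x \<noteq> y" using that False LP by auto
        note l = line_through[OF x y]
        have "c y \<in> c ` (line_through x y - {x})" using l(3) y by blast
        then show ?thesis using bspec[OF pencil l(1)] l(2) by fastforce
      qed
      then show ?thesis by (intro two[of \<beta> \<gamma>] image_subsetI)
    qed
  next
    fix M assume M: "M \<in> Lines" and off: "c ` (P - M) = {\<alpha>}" and on: "c ` M = {\<beta>, \<gamma>}"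
    show ?thesis
    proof (cases "L = M")
      case True
      then show ?thesis using on by (intro two[of \<beta> \<gamma>]) simp
    next
      case False
      then obtain q where q: "q \<in> L" "q \<in> M" using lines_meet[OF L M] by metis
      \<comment> \<open>\<open>L\<close> meets \<open>M\<close> only in \<open>q\<close>, so the
        rest of \<open>L\<close> lies off \<open>M\<close>.\<close>
      have "c y \<in> {\<alpha>, c q}" if y: "y \<in> L" for y
      proof (cases "y = q")
        case False
        then have "y \<in> P - M" using line_eqI[OF L M y q(1) _ q(2)] \<open>L \<noteq> M\<close> y LP by blast
        then have "c y \<in> c ` (P - M)" by (rule imageI)
        then show ?thesis using off by simp
      qed simp
      then show ?thesis by (intro two[of \<alpha> "c q"] image_subsetI)
    qed
  qed
qed

text \<open>Once exactly three colours are known to occur, the bound on lines says that each line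
  misses a colour class, and \<open>exceptional_colouring_cases\<close> applies.\<close>

lemma (in projective_plane) exceptional_colouring_if_lines_two_coloured:
  assumes lines: "\<And>L. L \<in> Lines \<Longrightarrow> card (c ` L) \<le> 2" and many: "\<not> card (c ` P) \<le> 2"
  shows "\<exists>\<alpha> \<beta> \<gamma>. exceptional_colouring P Lines c \<alpha> \<beta> \<gamma>"
proof -
  have no3: "c u = c v \<or> c v = c w \<or> c w = c u"
    if "L \<in> Lines" "u \<in> L" "v \<in> L" "w \<in> L" for L u v w
  proof (rule ccontr)
    assume "\<not> ?thesis"
    then have "card {c u, c v, c w} = 3" by auto
    moreover have "card {c u, c v, c w} \<le> card (c ` L)"
      using that finite_line by (intro card_mono) auto
    ultimately show False using lines[OF that(1)] by simp
  qed
  have "3 \<le> card (c ` P)" using many by simp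
  then obtain T where T: "T \<subseteq> c ` P" "card T = 3" by (meson obtain_subset_with_card_n)
  then obtain \<alpha> \<beta> \<gamma> where T_eq: "T = {\<alpha>, \<beta>, \<gamma>}"
    and d: "\<alpha> \<noteq> \<beta>" "\<beta> \<noteq> \<gamma>" "\<gamma> \<noteq> \<alpha>"
    unfolding card_3_iff by metis
  have "\<alpha> \<in> c ` P" "\<beta> \<in> c ` P" "\<gamma> \<in> c ` P" using T(1) T_eq by simp_all
  then obtain u v w where uvw: "u \<in> P" "v \<in> P" "w \<in> P" "c u = \<alpha>" "c v = \<beta>" "c w = \<gamma>"
    by (elim imageE) simp
  \<comment> \<open>With a fourth colour at \<open>y\<close>, the line joining \<open>u\<close> and
    \<open>v\<close> has just the colours \<alpha> and \<beta>, and the line joining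
    \<open>w\<close> and \<open>y\<close> just \<gamma> and \<open>c y\<close>. Their common point
    could then have no colour.\<close>
  have only: "c y = \<alpha> \<or> c y = \<beta> \<or> c y = \<gamma>" if y: "y \<in> P" for y
  proof (rule ccontr)
    assume n: "\<not> ?thesis"
    have "u \<noteq> v" "w \<noteq> y" using uvw d n by auto
    note 1 = line_through[OF uvw(1,2) this(1)] and 2 = line_through[OF uvw(3) y this(2)]
    have "line_through u v \<noteq> line_through w y"
    proof
      assume "line_through u v = line_through w y"
      then have "w \<in> line_through u v" using 2(2) by simp
      from no3[OF 1 this] show False using uvw d by simp
    qed
    then obtain q where "q \<in> line_through u v" "q \<in> line_through w y"
      by (rule lines_meet[OF 1(1) 2(1)])
    from no3[OF 1 this(1)] no3[OF 2 this(2)] show False using uvw d n by metis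
  qed
  have "three_coloured_plane P Lines c \<alpha> \<beta> \<gamma>"
  proof
    show "P = {y \<in> P. c y = \<alpha>} \<union> {y \<in> P. c y = \<beta>} \<union> {y \<in> P. c y = \<gamma>}" using only by blast
    fix L assume L: "L \<in> Lines"
    show "L \<inter> {y \<in> P. c y = \<alpha>} = {} \<or> L \<inter> {y \<in> P. c y = \<beta>} = {} \<or> L \<inter> {y \<in> P. c y = \<gamma>} = {}"
    proof (rule ccontr)
      assume "\<not> ?thesis"
      then obtain r s t where "r \<in> L" "s \<in> L" "t \<in> L" "c r = \<alpha>" "c s = \<beta>" "c t = \<gamma>" by blast
      then show False using no3[OF L, of r s t] d by simp
    qed
  qed (use uvw d in auto)
  from three_coloured_plane.exceptional_colouring_cases[OF this] show ?thesis by blast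
qed

theorem theorem6p9:
  fixes P :: "'a set" and Lines :: "'a set set" and c :: "'a \<Rightarrow> 'b"
  assumes "projective_plane P Lines"
  shows "(\<forall>L\<in>Lines. card (c ` L) \<le> 2) \<longleftrightarrow>
    (card (c ` P) \<le> 2 \<or>
     (\<exists>\<alpha> \<beta>\<^sub>1 \<beta>\<^sub>2. c ` P = {\<alpha>, \<beta>\<^sub>1, \<beta>\<^sub>2} \<and>
       ((\<exists>x\<in>P. c x = \<alpha> \<and>
          (\<forall>L\<in>Lines. x \<in> L \<longrightarrow> c ` (L - {x}) = {\<beta>\<^sub>1} \<or> c ` (L - {x}) = {\<beta>\<^sub>2})) \<or>
        (\<exists>L\<in>Lines. c ` (P - L) = {\<alpha>} \<and> c ` L = {\<beta>\<^sub>1, \<beta>\<^sub>2} \<and>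
          card {y \<in> L. c y = \<beta>\<^sub>1} \<ge> 2 \<and> card {y \<in> L. c y = \<beta>\<^sub>2} \<ge> 2))))"
proof -
  interpret projective_plane P Lines by (rule assms)
  have "(\<forall>L\<in>Lines. card (c ` L) \<le> 2) \<longleftrightarrow>
      card (c ` P) \<le> 2 \<or> (\<exists>\<alpha> \<beta> \<gamma>. exceptional_colouring P Lines c \<alpha> \<beta> \<gamma>)"
  proof (intro iffI ballI)
    fix L assume "card (c ` P) \<le> 2 \<or> (\<exists>\<alpha> \<beta> \<gamma>. exceptional_colouring P Lines c \<alpha> \<beta> \<gamma>)"
      and L: "L \<in> Lines"
    moreover have "card (c ` L) \<le> card (c ` P)"
      using finite_points line_subset[OF L] by (intro card_mono image_mono) auto
    ultimately show "card (c ` L) \<le> 2" using card_colours_le_2I[OF _ L] by fastforce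
  qed (use exceptional_colouring_if_lines_two_coloured in blast)
  then show ?thesis unfolding exceptional_colouring_def .
qed

end
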